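(* There exists a numerical constant $c>0$ (an absolute constant, independent of all parameters) such that the following holds. Let $M>0$. There exists a constant $\varepsilon>0$, depending only on $M$, such that for all transport coefficients $a<0$, $b<0$ and all CFL parameters $\lambda>0$, $\mu>0$ satisfying $$\lambda\,|a|\,\le\,M\,\mu\,|b|\quad\text{and}\quad \mu\,|b|\,\le\,M\,\lambda\,|a|,$$ and $$(\lambda\,a)^2+(\mu\,b)^2\,\le\,\varepsilon,$$ and for every initial condition $u^0\in\ell^2(\mathbb{N}^2;\mathbb{R})$, the solution $(u^n)_{n\in\mathbb{N}}$ to the Lax-Wendroff scheme with second order extrapolation boundary and corner conditions (as defined in the context) satisfies, for every $n\in\mathbb{N}$, the energy estimate $$\begin{aligned} \|u^{n+1}\|^2-\|u^n\|^2 &+ c\,(\lambda a)^2\sum_{j,k\ge1}(u^n_{j-1,k}-2u^n_{j,k}+u^n_{j+1,k})^2 + c\,(\mu b)^2\sum_{j,k\ge1}(u^n_{j,k-1}-2u^n_{j,k}+u^n_{j,k+1})^2\\ &+ c\,\lambda|a|\sum_{k\ge0}(u^n_{0,k})^2 + c\,\mu|b|\sum_{j\ge0}(u^n_{j,0})^2\;\le\;0 . \end{aligned}$$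
   Context: $\mathbb{N}=\{0,1,2,\dots\}$. For $\mathcal{J}\subset\mathbb{Z}^2$, $\ell^2(\mathcal{J};\mathbb{R})$ is the space of real square summable sequences indexed by $\mathcal{J}$. Numerical scheme. Given $u^0=(u^0_{j,k})_{(j,k)\in\mathbb{N}^2}$, the sequences $u^n=(u^n_{j,k})$ are defined inductively in $n\in\mathbb{N}$ as follows. Given the interior values $u^n_{j,k}$, $(j,k)\in\mathbb{N}^2$, the ghost values are defined by $$u^n_{-1,k}=2u^n_{0,k}-u^n_{1,k}\ (k\in\mathbb{N}),\qquad u^n_{j,-1}=2u^n_{j,0}-u^n_{j,1}\ (j\in\mathbb{N}),$$ $$u^n_{-1,-1}=4u^n_{0,0}-2u^n_{1,0}-2u^n_{0,1}+u^n_{1,1},$$ and then for all $(j,k)\in\mathbb{N}^2$, $$\begin{aligned} u^{n+1}_{j,k}={}&u^n_{j,k}-\tfrac{\lambda a}{2}(u^n_{j+1,k}-u^n_{j-1,k})-\tfrac{\mu b}{2}(u^n_{j,k+1}-u^n_{j,k-1})\\ &+\tfrac{(\lambda a)^2}{2}(u^n_{j+1,k}-2u^n_{j,k}+u^n_{j-1,k})+\tfrac{(\mu b)^2}{2}(u^n_{j,k+1}-2u^n_{j,k}+u^n_{j,k-1})\\ &+\tfrac{\lambda a\,\mu b}{4}(u^n_{j+1,k+1}-u^n_{j+1,k-1}-u^n_{j-1,k+1}+u^n_{j-1,k-1})\\ &-\tfrac{(\lambda a)^2+(\mu b)^2}{8}\big(u^n_{j+1,k+1}-2u^n_{j+1,k}+u^n_{j+1,k-1}-2u^n_{j,k+1}+4u^n_{j,k}-2u^n_{j,k-1}\\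 &\qquad\qquad\qquad\quad+u^n_{j-1,k+1}-2u^n_{j-1,k}+u^n_{j-1,k-1}\big). \end{aligned}$$ Norm. $\|u\|^2:=\sum_{j,k\ge1}u_{j,k}^2+\frac12\sum_{k\ge1}u_{0,k}^2+\frac12\sum_{j\ge1}u_{j,0}^2+\frac14u_{0,0}^2$ (only interior indices $(j,k)\in\mathbb{N}^2$ are involved). *)

theory Defs
  imports "HOL-Analysis.Infinite_Sum"
begin

definition square_summable :: "(nat \<Rightarrow> nat \<Rightarrow> real) \<Rightarrow> bool" where
  "square_summable u \<longleftrightarrow> (\<lambda>(j, k). (u j k)\<^sup>2) summable_on (UNIV :: (nat \<times> nat) set)"

(* Interior values on N^2 completed by the ghost values at j = -1 and k = -1.
   The scheme never reads an index below -1; the value 0 there is arbitrary. *)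
definition with_ghosts :: "(nat \<Rightarrow> nat \<Rightarrow> real) \<Rightarrow> int \<Rightarrow> int \<Rightarrow> real" where
  "with_ghosts u j k =
    (if j \<ge> 0 \<and> k \<ge> 0 then u (nat j) (nat k)
     else if j = -1 \<and> k \<ge> 0 then 2 * u 0 (nat k) - u 1 (nat k)
     else if j \<ge> 0 \<and> k = -1 then 2 * u (nat j) 0 - u (nat j) 1
     else if j = -1 \<and> k = -1 then 4 * u 0 0 - 2 * u 1 0 - 2 * u 0 1 + u 1 1
     else 0)"

(* One Lax-Wendroff update at (j, k), for a sequence w that is defined at the ghost indices too. *)
definition lax_wendroff_stencil ::
  "real \<Rightarrow> real \<Rightarrow> real \<Rightarrow> real \<Rightarrow> (int \<Rightarrow> int \<Rightarrow> real) \<Rightarrow> int \<Rightarrow> int \<Rightarrow> real" where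
  "lax_wendroff_stencil a b lam mu w j k =
     w j k
     - lam * a / 2 * (w (j + 1) k - w (j - 1) k)
     - mu * b / 2 * (w j (k + 1) - w j (k - 1))
     + (lam * a)\<^sup>2 / 2 * (w (j + 1) k - 2 * w j k + w (j - 1) k)
     + (mu * b)\<^sup>2 / 2 * (w j (k + 1) - 2 * w j k + w j (k - 1))
     + lam * a * mu * b / 4 *
         (w (j + 1) (k + 1) - w (j + 1) (k - 1) - w (j - 1) (k + 1) + w (j - 1) (k - 1))
     - ((lam * a)\<^sup>2 + (mu * b)\<^sup>2) / 8 *
         (w (j + 1) (k + 1) - 2 * w (j + 1) k + w (j + 1) (k - 1)
          - 2 * w j (k + 1) + 4 * w j k - 2 * w j (k - 1)
          + w (j - 1) (k + 1) - 2 * w (j - 1) k + w (j - 1) (k - 1))"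

primrec lax_wendroff ::
  "real \<Rightarrow> real \<Rightarrow> real \<Rightarrow> real \<Rightarrow> (nat \<Rightarrow> nat \<Rightarrow> real) \<Rightarrow> nat \<Rightarrow> nat \<Rightarrow> nat \<Rightarrow> real" where
  "lax_wendroff a b lam mu u0 0 = u0"
| "lax_wendroff a b lam mu u0 (Suc n) =
     (\<lambda>j k. lax_wendroff_stencil a b lam mu
        (with_ghosts (lax_wendroff a b lam mu u0 n)) (int j) (int k))"

(* The square of the weighted norm. Here and in the energy estimate every infinite sum is over a
   summable family once u is square summable, a property that each step of the scheme preserves;
   the value 0 of infsum on non-summable families therefore plays no role. *)
definition norm_sq :: "(nat \<Rightarrow> nat \<Rightarrow> real) \<Rightarrow> real" where
  "norm_sq u =
     (\<Sum>\<^sub>\<infinity>(j, k)\<in>{1..} \<times> {1..}. (u j k)\<^sup>2)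
     + 1 / 2 * (\<Sum>\<^sub>\<infinity>k\<in>{1..}. (u 0 k)\<^sup>2)
     + 1 / 2 * (\<Sum>\<^sub>\<infinity>j\<in>{1..}. (u j 0)\<^sup>2)
     + 1 / 4 * (u 0 0)\<^sup>2"

end

theory Submission
  imports Defs
begin

text \<open>
  Second order extrapolation at the ghost points amounts to the summation-by-parts operators
  \<open>Dx\<close> (one-sided at \<open>j = 0\<close>) and \<open>Lx\<close> (zero at \<open>j = 0\<close>), and the norm of the paper gives the
  boundary index the matching weight \<open>1 / 2\<close>. With \<open>p = \<lambda>\<bar>a\<bar>\<close> and \<open>q = \<mu>\<bar>b\<bar>\<close> one step of the scheme is
  \<open>u + A u + B u\<close>, where \<open>A = p Dx + q Dy\<close> and
  \<open>B = p\<^sup>2/2 Lx + q\<^sup>2/2 Ly + p q Dx Dy - (p\<^sup>2 + q\<^sup>2)/8 Lx Ly\<close>. In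
  \<open>\<parallel>u + A u + B u\<parallel>\<^sup>2 - \<parallel>u\<parallel>\<^sup>2 = 2\<langle>u, A u\<rangle> + (2\<langle>u, B u\<rangle> + \<parallel>A u\<parallel>\<^sup>2) + 2\<langle>A u, B u\<rangle> + \<parallel>B u\<parallel>\<^sup>2\<close>
  the first order term gives the dissipation \<open>- p |u\<^sub>0\<^sub>,\<^sub>\<cdot>|\<^sup>2\<close> of the traces, the second order term the
  interior dissipation of \<open>Lx u\<close>, \<open>Ly u\<close> and of the mixed difference \<open>dx dy u\<close>, and the third order
  term, which consists of boundary terms only, the dissipation \<open>- p\<^sup>3/2 |dx u\<^sub>0\<^sub>,\<^sub>\<cdot>|\<^sup>2\<close>. All other terms
  are absorbed by these when \<open>p\<close> and \<open>q\<close> are small and comparable.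
\<close>

subsection \<open>Difference operators and weights\<close>

definition flip :: "(nat \<Rightarrow> nat \<Rightarrow> real) \<Rightarrow> nat \<Rightarrow> nat \<Rightarrow> real" where
  "flip f = (\<lambda>j k. f k j)"

definition dx :: "(nat \<Rightarrow> nat \<Rightarrow> real) \<Rightarrow> nat \<Rightarrow> nat \<Rightarrow> real" where
  "dx f = (\<lambda>j k. f (Suc j) k - f j k)"

definition Lx :: "(nat \<Rightarrow> nat \<Rightarrow> real) \<Rightarrow> nat \<Rightarrow> nat \<Rightarrow> real" where
  "Lx f = (\<lambda>j k. if j = 0 then 0 else f (Suc j) k - 2 * f j k + f (j - 1) k)"

definition Dx :: "(nat \<Rightarrow> nat \<Rightarrow> real) \<Rightarrow> nat \<Rightarrow> nat \<Rightarrow> real" where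
  "Dx f = (\<lambda>j k. if j = 0 then f 1 k - f 0 k else (f (Suc j) k - f (j - 1) k) / 2)"

text \<open>Conjugation with \<open>flip\<close> lets every fact about the second variable be read
  off from the first variable, since \<open>flip\<close> merely exchanges the two weights of
  \<open>wsum\<close>.\<close>

definition dy where "dy f = flip (dx (flip f))"
definition Ly where "Ly f = flip (Lx (flip f))"
definition Dy where "Dy f = flip (Dx (flip f))"

definition weight :: "(nat \<Rightarrow> real) \<Rightarrow> bool" where
  "weight a \<longleftrightarrow> (\<forall>j. 0 \<le> a j \<and> a j \<le> 1)"

text \<open>\<open>half\<close> is the quadrature weight of the norm, \<open>one\<close> goes with
  \<open>dx f\<close>, whose entries sit midway between grid points, and \<open>edge\<close> selects
  the trace at index 0.\<close>

definition one :: "nat \<Rightarrow> real" where "one j = 1"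
definition half :: "nat \<Rightarrow> real" where "half j = (if j = 0 then 1 / 2 else 1)"
definition edge :: "nat \<Rightarrow> real" where "edge j = (if j = 0 then 1 else 0)"

text \<open>With one weight per variable, summation by parts in one variable leaves the other weight
  arbitrary, so a single identity serves the interior, the traces and the corner.\<close>

definition wsum ::
  "(nat \<Rightarrow> real) \<Rightarrow> (nat \<Rightarrow> real) \<Rightarrow> (nat \<Rightarrow> nat \<Rightarrow> real) \<Rightarrow> (nat \<Rightarrow> nat \<Rightarrow> real) \<Rightarrow> real" where
  "wsum a b f g = (\<Sum>\<^sub>\<infinity>(j, k). a j * b k * (f j k * g j k))"

lemma flip_flip [simp]: "flip (flip f) = f"
  by (simp add: flip_def)

lemma weight_one [simp]: "weight one" and weight_half [simp]: "weight half"
  and weight_edge [simp]: "weight edge"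
  by (auto simp: weight_def one_def half_def edge_def)

subsection \<open>Square summable families\<close>

lemma square_summable_dominated:
  assumes "square_summable g" "square_summable h"
    and "\<And>j k. (f j k)\<^sup>2 \<le> C * ((g j k)\<^sup>2 + (h j k)\<^sup>2)"
  shows "square_summable f"
proof -
  have "(\<lambda>(j, k). C * ((g j k)\<^sup>2 + (h j k)\<^sup>2)) summable_on UNIV"
    using summable_on_cmult_right[OF summable_on_add[OF assms(1,2)[unfolded square_summable_def]], of C]
    by (simp add: case_prod_unfold)
  then show ?thesis
    unfolding square_summable_def
    by (rule summable_on_comparison_test) (use assms(3) in auto)
qed

lemma square_summable_add [simp]:
  assumes "square_summable f" "square_summable g"
  shows "square_summable (\<lambda>j k. f j k + g j k)"
proof (rule square_summable_dominated[OF assms, where C = 2])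
  show "(f j k + g j k)\<^sup>2 \<le> 2 * ((f j k)\<^sup>2 + (g j k)\<^sup>2)" for j k
    using sum_squares_bound[of "f j k" "g j k"] by (simp add: power2_sum)
qed

lemma square_summable_scale [simp]:
  assumes "square_summable f"
  shows "square_summable (\<lambda>j k. c * f j k)"
  by (rule square_summable_dominated[OF assms assms, where C = "c\<^sup>2"])
    (simp add: power_mult_distrib mult_left_mono)

lemma square_summable_diff [simp]:
  assumes "square_summable f" "square_summable g"
  shows "square_summable (\<lambda>j k. f j k - g j k)"
  using square_summable_add[OF assms(1) square_summable_scale[OF assms(2), of "-1"]] by simp

lemma square_summable_flip [simp]: "square_summable (flip f) \<longleftrightarrow> square_summable f"
  unfolding square_summable_def flip_def
  using summable_on_reindex_bij_betw[of prod.swap UNIV UNIV "\<lambda>(j, k). (f j k)\<^sup>2"]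
  by (simp add: case_prod_unfold bij_swap)

lemma range_Suc_fst: "range (\<lambda>(j, k). (Suc j, k)) = {(j, k). j \<noteq> 0}"
proof -
  have "(j, k) \<in> range (\<lambda>(j, k). (Suc j, k))" if "j \<noteq> 0" for j and k :: 'a
    using rangeI[of "\<lambda>(j, k). (Suc j, k)" "(j - 1, k)"] that by simp
  then show ?thesis by auto
qed

lemma inj_Suc_fst: "inj (\<lambda>(j, k). (Suc j, k))"
  by (auto simp: inj_on_def)

lemma square_summable_Suc:
  assumes "square_summable f"
  shows "square_summable (\<lambda>j k. f (Suc j) k)"
proof -
  have "(\<lambda>(j, k). (f j k)\<^sup>2) summable_on range (\<lambda>(j, k). (Suc j, k))"
    using assms summable_on_subset_banach unfolding square_summable_def by blast
  then show ?thesis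
    unfolding summable_on_reindex[OF inj_Suc_fst] square_summable_def
    by (simp add: case_prod_unfold o_def)
qed

lemma has_sum_pred:
  fixes G :: "nat \<Rightarrow> nat \<Rightarrow> real"
  assumes "((\<lambda>(j, k). G j k) has_sum x) UNIV"
  shows "((\<lambda>(j, k). if j = 0 then 0 else G (j - 1) k) has_sum x) UNIV"
proof -
  let ?H = "\<lambda>(j, k). if j = 0 then 0 else G (j - 1) k"
  have "(?H \<circ> (\<lambda>(j, k). (Suc j, k)) has_sum x) UNIV"
    using assms by (simp add: case_prod_unfold o_def)
  then have "(?H has_sum x) {(j, k). j \<noteq> 0}"
    using has_sum_reindex[OF inj_Suc_fst, of ?H x] unfolding range_Suc_fst by blast
  moreover have "(?H has_sum x) UNIV \<longleftrightarrow> (?H has_sum x) {(j, k). j \<noteq> 0}"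
    by (rule has_sum_cong_neutral) auto
  ultimately show ?thesis by simp
qed

lemma square_summable_pred:
  assumes "square_summable f"
  shows "square_summable (\<lambda>j k. if j = 0 then 0 else f (j - 1) k)"
proof -
  have "((\<lambda>(j, k). (f j k)\<^sup>2) has_sum (\<Sum>\<^sub>\<infinity>(j, k). (f j k)\<^sup>2)) UNIV"
    using assms unfolding square_summable_def by (rule has_sum_infsum)
  from has_sum_imp_summable[OF has_sum_pred[OF this]]
  show ?thesis
    by (simp add: square_summable_def if_distrib[of "\<lambda>x. x\<^sup>2"] cong: if_cong)
qed

lemma square_summable_dx [simp]: "square_summable f \<Longrightarrow> square_summable (dx f)"
  unfolding dx_def by (intro square_summable_diff square_summable_Suc)

lemma Lx_eq_dx_dx: "Lx f = (\<lambda>j k. if j = 0 then 0 else dx (dx f) (j - 1) k)"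
  by (auto simp: Lx_def dx_def fun_eq_iff)

lemma Dx_eq_dx_Lx: "Dx f = (\<lambda>j k. dx f j k - 1 / 2 * Lx f j k)"
  by (auto simp: Lx_def dx_def Dx_def fun_eq_iff field_simps)

lemma square_summable_Lx [simp]: "square_summable f \<Longrightarrow> square_summable (Lx f)"
  unfolding Lx_eq_dx_dx by (intro square_summable_pred square_summable_dx)

lemma square_summable_Dx [simp]: "square_summable f \<Longrightarrow> square_summable (Dx f)"
  unfolding Dx_eq_dx_Lx
  by (intro square_summable_diff square_summable_scale square_summable_dx square_summable_Lx)

lemma square_summable_y [simp]:
  assumes "square_summable f"
  shows "square_summable (dy f)" "square_summable (Ly f)" "square_summable (Dy f)"
  using assms by (simp_all add: dy_def Ly_def Dy_def)

lemma commute_xy: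
  "dx (dy f) = dy (dx f)" "dx (Ly f) = Ly (dx f)" "dx (Dy f) = Dy (dx f)"
  "Lx (dy f) = dy (Lx f)" "Lx (Ly f) = Ly (Lx f)" "Lx (Dy f) = Dy (Lx f)"
  "Dx (dy f) = dy (Dx f)" "Dx (Ly f) = Ly (Dx f)" "Dx (Dy f) = Dy (Dx f)"
  by (auto simp: dx_def dy_def Lx_def Ly_def Dx_def Dy_def flip_def fun_eq_iff field_simps)

subsection \<open>Weighted bilinear forms\<close>

text \<open>Absolute convergence follows from |f g| \<le> f^2 + g^2 and weights in [0, 1]. Hence the
  default value of \<open>infsum\<close> never enters a form of square summable families.\<close>

lemma has_sum_wsum:
  assumes "weight a" "weight b" "square_summable f" "square_summable g"
  shows "((\<lambda>(j, k). a j * b k * (f j k * g j k)) has_sum wsum a b f g) UNIV"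
proof -
  have S: "(\<lambda>(j, k). (f j k)\<^sup>2 + (g j k)\<^sup>2) summable_on UNIV"
    using summable_on_add[OF assms(3,4)[unfolded square_summable_def]]
    by (simp add: case_prod_unfold)
  have "\<bar>a j * b k * (f j k * g j k)\<bar> \<le> (f j k)\<^sup>2 + (g j k)\<^sup>2" for j k
  proof -
    have "\<bar>a j * b k\<bar> \<le> 1"
      using assms(1,2) by (simp add: weight_def abs_mult mult_le_one)
    moreover have "\<bar>f j k * g j k\<bar> \<le> (f j k)\<^sup>2 + (g j k)\<^sup>2"
    proof -
      have "2 * \<bar>f j k * g j k\<bar> \<le> (f j k)\<^sup>2 + (g j k)\<^sup>2"
        using sum_squares_bound[of "\<bar>f j k\<bar>" "\<bar>g j k\<bar>"] by (simp add: abs_mult mult.assoc)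
      then show ?thesis
        using abs_ge_zero[of "f j k * g j k"] by linarith
    qed
    ultimately show ?thesis
      unfolding abs_mult[of "a j * b k"]
      by (meson abs_ge_zero mult_left_le_one_le order_trans)
  qed
  then have "(\<lambda>(j, k). a j * b k * (f j k * g j k)) abs_summable_on UNIV"
    by (intro abs_summable_on_comparison_test'[OF S]) auto
  then show ?thesis
    unfolding wsum_def using abs_summable_summable has_sum_infsum by blast
qed

lemma wsum_flip: "wsum a b (flip f) (flip g) = wsum b a f g"
proof -
  have "wsum b a f g = (\<Sum>\<^sub>\<infinity>x. (\<lambda>(j, k). b j * a k * (f j k * g j k)) (prod.swap x))"
    unfolding wsum_def by (rule infsum_reindex_bij_betw[symmetric]) (simp add: bij_swap)
  then show ?thesis
    by (simp add: wsum_def flip_def case_prod_unfold mult_ac)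
qed

lemma wsum_commute: "wsum a b f g = wsum a b g f"
  by (simp add: wsum_def mult_ac)

lemma wsum_add_left:
  assumes "weight a" "weight b" "square_summable f" "square_summable g" "square_summable h"
  shows "wsum a b (\<lambda>j k. f j k + g j k) h = wsum a b f h + wsum a b g h"
  using infsumI[OF has_sum_add[OF has_sum_wsum[OF assms(1-3,5)] has_sum_wsum[OF assms(1,2,4,5)]]]
  by (simp add: wsum_def case_prod_unfold algebra_simps)

lemma wsum_scale_left: "wsum a b (\<lambda>j k. c * f j k) h = c * wsum a b f h"
  unfolding wsum_def infsum_cmult_right'[symmetric] by (simp add: case_prod_unfold mult_ac)

lemma wsum_add_right:
  assumes "weight a" "weight b" "square_summable f" "square_summable g" "square_summable h"
  shows "wsum a b h (\<lambda>j k. f j k + g j k) = wsum a b h f + wsum a b h g"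
  using wsum_add_left[OF assms] by (simp add: wsum_commute)

lemma wsum_scale_right: "wsum a b h (\<lambda>j k. c * f j k) = c * wsum a b h f"
  using wsum_scale_left by (simp add: wsum_commute)

lemma wsum_diff_right:
  assumes "weight a" "weight b" "square_summable f" "square_summable g" "square_summable h"
  shows "wsum a b h (\<lambda>j k. f j k - g j k) = wsum a b h f - wsum a b h g"
  using wsum_add_right[OF assms(1-3) square_summable_scale[OF assms(4), of "-1"] assms(5)]
    wsum_scale_right[of a b h "-1" g] by simp

lemma wsum_diff_left:
  assumes "weight a" "weight b" "square_summable f" "square_summable g" "square_summable h"
  shows "wsum a b (\<lambda>j k. f j k - g j k) h = wsum a b f h - wsum a b g h"
  using wsum_diff_right[OF assms] by (simp add: wsum_commute)

lemmas wsum_bilinear = wsum_add_left wsum_add_right wsum_scale_left wsum_scale_right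
  wsum_diff_left wsum_diff_right

lemma wsum_nonneg:
  assumes "weight a" "weight b"
  shows "0 \<le> wsum a b f f"
  unfolding wsum_def by (rule infsum_nonneg) (use assms in \<open>auto simp: weight_def\<close>)

lemma wsum_mono_weight:
  assumes "weight a" "weight b" "weight a'" "weight b'" "square_summable f"
    and le: "\<And>j k. a j * b k \<le> C * (a' j * b' k)"
  shows "wsum a b f f \<le> C * wsum a' b' f f"
proof (rule has_sum_mono[OF has_sum_wsum[OF assms(1,2,5,5)]
      has_sum_cmult_right[OF has_sum_wsum[OF assms(3,4,5,5)]]])
  show "(case x of (j, k) \<Rightarrow> a j * b k * (f j k * f j k))
      \<le> C * (case x of (j, k) \<Rightarrow> a' j * b' k * (f j k * f j k))" for x
    using mult_right_mono[OF le, of "f j k * f j k" for j k]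
    by (auto simp: case_prod_unfold mult_ac)
qed

text \<open>The square of \<open>t * f - d * g\<close> has a nonnegative sum; dividing by
  \<open>t\<close> and taking d = 1/2 and d = -1/2 bounds the product from both sides.\<close>

lemma wsum_young:
  assumes "weight a" "weight b" "square_summable f" "square_summable g" "t > 0"
  shows "\<bar>wsum a b f g\<bar> \<le> t * wsum a b f f + 1 / (4 * t) * wsum a b g g"
proof -
  have *: "2 * d * wsum a b f g \<le> t * wsum a b f f + 1 / (4 * t) * wsum a b g g"
    if "d * d = 1 / 4" for d
  proof -
    let ?h = "\<lambda>j k. t * f j k - d * g j k"
    have "wsum a b ?h ?h = t * t * wsum a b f f - 2 * d * t * wsum a b f g + d * d * wsum a b g g"
      using assms by (simp add: wsum_bilinear wsum_commute[of _ _ g f] algebra_simps)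
    then have "0 \<le> (t * t * wsum a b f f - 2 * d * t * wsum a b f g + 1 / 4 * wsum a b g g) / t"
      using wsum_nonneg[OF assms(1,2), of ?h] that \<open>t > 0\<close> by simp
    then show ?thesis
      using \<open>t > 0\<close> by (simp add: field_simps)
  qed
  show ?thesis
    using *[of "1 / 2"] *[of "- 1 / 2"] by simp
qed

subsection \<open>Summation by parts\<close>

text \<open>A summable family and its shift by one row have the same sum, so no limit at infinity is
  needed. Each identity below exhibits such a flux \<open>G\<close>; boundary terms come from row 0,
  where the preceding value of \<open>G\<close> counts as 0.\<close>

lemma has_sum_telescope:
  fixes G :: "nat \<Rightarrow> nat \<Rightarrow> real"
  assumes "((\<lambda>(j, k). G j k) has_sum x) UNIV"
    and "\<And>j k. F j k = (if j = 0 then G 0 k else G j k - G (j - 1) k)"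
  shows "((\<lambda>(j, k). F j k) has_sum 0) UNIV"
proof -
  have "((\<lambda>z. (case z of (j, k) \<Rightarrow> G j k) + - (case z of (j, k) \<Rightarrow> if j = 0 then 0 else G (j - 1) k))
      has_sum (x + - x)) UNIV"
    by (intro has_sum_add has_sum_uminusI assms(1) has_sum_pred)
  moreover have "(case z of (j, k) \<Rightarrow> G j k) + - (case z of (j, k) \<Rightarrow> if j = 0 then 0 else G (j - 1) k)
      = (case z of (j, k) \<Rightarrow> F j k)" for z
    by (auto simp: assms(2) split: prod.split)
  ultimately show ?thesis by simp
qed

text \<open>The flux is (f_{j+1} g_j + f_j g_{j+1}) / 2. The weight 1/2 at j = 0 matches the
  one-sided difference there, so that exactly the trace product f_0 g_0 is left over.\<close>

lemma sbp_Dx: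
  assumes [simp]: "weight b" "square_summable f" "square_summable g"
  shows "wsum half b (Dx f) g + wsum half b f (Dx g) = - wsum edge b f g"
proof -
  let ?Sf = "\<lambda>j k. f (Suc j) k" and ?Sg = "\<lambda>j k. g (Suc j) k"
  note [simp] = square_summable_Suc
  have G: "((\<lambda>(j, k). 1 / 2 * b k * (f (Suc j) k * g j k + f j k * g (Suc j) k)) has_sum
      1 / 2 * (wsum one b ?Sf g + wsum one b f ?Sg)) UNIV"
    using has_sum_cmult_right[OF has_sum_add[OF has_sum_wsum[of one b ?Sf g] has_sum_wsum[of one b f ?Sg]],
        of "1 / 2"]
    by (simp add: case_prod_unfold one_def algebra_simps)
  have "((\<lambda>(j, k). half j * b k * (Dx f j k * g j k) + half j * b k * (f j k * Dx g j k)
      + edge j * b k * (f j k * g j k)) has_sum 0) UNIV"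
    by (rule has_sum_telescope[OF G])
      (auto simp: half_def edge_def Dx_def field_simps)
  moreover have "((\<lambda>(j, k). half j * b k * (Dx f j k * g j k) + half j * b k * (f j k * Dx g j k)
      + edge j * b k * (f j k * g j k)) has_sum
      (wsum half b (Dx f) g + wsum half b f (Dx g) + wsum edge b f g)) UNIV"
    using has_sum_add[OF has_sum_add[OF has_sum_wsum[of half b "Dx f" g] has_sum_wsum[of half b f "Dx g"]]
        has_sum_wsum[of edge b f g]]
    by (simp add: case_prod_unfold)
  ultimately have "wsum half b (Dx f) g + wsum half b f (Dx g) + wsum edge b f g = 0"
    using has_sum_unique by blast
  then show ?thesis by simp
qed

lemma sbp_Lx:
  assumes [simp]: "weight b" "square_summable f" "square_summable g"
  shows "wsum half b f (Lx g) = - wsum one b (dx f) (dx g) - wsum edge b f (dx g)"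
proof -
  let ?Sf = "\<lambda>j k. f (Suc j) k"
  note [simp] = square_summable_Suc
  have G: "((\<lambda>(j, k). b k * (f (Suc j) k * dx g j k)) has_sum wsum one b ?Sf (dx g)) UNIV"
    using has_sum_wsum[of one b ?Sf "dx g"] by (simp add: one_def)
  have "((\<lambda>(j, k). half j * b k * (f j k * Lx g j k) + one j * b k * (dx f j k * dx g j k)
      + edge j * b k * (f j k * dx g j k)) has_sum 0) UNIV"
    by (rule has_sum_telescope[OF G])
      (auto simp: half_def edge_def one_def Lx_def dx_def algebra_simps)
  moreover have "((\<lambda>(j, k). half j * b k * (f j k * Lx g j k) + one j * b k * (dx f j k * dx g j k)
      + edge j * b k * (f j k * dx g j k)) has_sum
      (wsum half b f (Lx g) + wsum one b (dx f) (dx g) + wsum edge b f (dx g))) UNIV"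
    using has_sum_add[OF has_sum_add[OF has_sum_wsum[of half b f "Lx g"]
          has_sum_wsum[of one b "dx f" "dx g"]] has_sum_wsum[of edge b f "dx g"]]
    by (simp add: case_prod_unfold)
  ultimately have "wsum half b f (Lx g) + wsum one b (dx f) (dx g) + wsum edge b f (dx g) = 0"
    using has_sum_unique by blast
  then show ?thesis by simp
qed

text \<open>For j > 0, \<open>Dx\<close> is the mean and \<open>Lx\<close> the difference of two
  consecutive values of \<open>dx f\<close>, so the product is half a difference of squares and
  telescopes. This produces the third order dissipation of the normal difference at the
  boundary.\<close>

lemma sbp_Dx_Lx:
  assumes [simp]: "weight b" "square_summable f"
  shows "wsum half b (Dx f) (Lx f) = - 1 / 2 * wsum edge b (dx f) (dx f)"
proof -
  have G: "((\<lambda>(j, k). 1 / 2 * (b k * (dx f j k * dx f j k))) has_sum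
      1 / 2 * wsum one b (dx f) (dx f)) UNIV"
    using has_sum_cmult_right[OF has_sum_wsum[of one b "dx f" "dx f"], of "1 / 2"]
    by (simp add: one_def case_prod_unfold)
  have "((\<lambda>(j, k). half j * b k * (Dx f j k * Lx f j k)
      + 1 / 2 * (edge j * b k * (dx f j k * dx f j k))) has_sum 0) UNIV"
    by (rule has_sum_telescope[OF G])
      (auto simp: half_def edge_def Lx_def Dx_def dx_def field_simps)
  moreover have "((\<lambda>(j, k). half j * b k * (Dx f j k * Lx f j k)
      + 1 / 2 * (edge j * b k * (dx f j k * dx f j k))) has_sum
      (wsum half b (Dx f) (Lx f) + 1 / 2 * wsum edge b (dx f) (dx f))) UNIV"
    using has_sum_add[OF has_sum_wsum[of half b "Dx f" "Lx f"]
        has_sum_cmult_right[OF has_sum_wsum[of edge b "dx f" "dx f"], of "1 / 2"]]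
    by (simp add: case_prod_unfold)
  ultimately have "wsum half b (Dx f) (Lx f) + 1 / 2 * wsum edge b (dx f) (dx f) = 0"
    using has_sum_unique by blast
  then show ?thesis by simp
qed

text \<open>Parallelogram identity for two consecutive values of \<open>dx f\<close>: squared mean
  plus a quarter of the squared difference is the mean of the squares.\<close>

lemma wsum_dx_dx:
  assumes [simp]: "weight b" "square_summable f"
  shows "wsum one b (dx f) (dx f) = wsum half b (Dx f) (Dx f) + 1 / 4 * wsum half b (Lx f) (Lx f)"
proof -
  have G: "((\<lambda>(j, k). - 1 / 2 * (b k * (dx f j k * dx f j k))) has_sum
      - 1 / 2 * wsum one b (dx f) (dx f)) UNIV"
    using has_sum_cmult_right[OF has_sum_wsum[of one b "dx f" "dx f"], of "- 1 / 2"]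
    by (simp add: one_def case_prod_unfold)
  let ?F = "\<lambda>j k. half j * b k * (Dx f j k * Dx f j k)
      + 1 / 4 * (half j * b k * (Lx f j k * Lx f j k)) + - 1 * (one j * b k * (dx f j k * dx f j k))"
  have "((\<lambda>(j, k). ?F j k) has_sum 0) UNIV"
    by (rule has_sum_telescope[OF G])
      (auto simp: half_def one_def Lx_def Dx_def dx_def field_simps)
  moreover have "((\<lambda>(j, k). ?F j k) has_sum
      (wsum half b (Dx f) (Dx f) + 1 / 4 * wsum half b (Lx f) (Lx f)
       + - 1 * wsum one b (dx f) (dx f))) UNIV"
    using has_sum_add[OF has_sum_add[OF has_sum_wsum[of half b "Dx f" "Dx f"]
          has_sum_cmult_right[OF has_sum_wsum[of half b "Lx f" "Lx f"], of "1 / 4"]]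
        has_sum_cmult_right[OF has_sum_wsum[of one b "dx f" "dx f"], of "- 1"]]
    by (simp add: case_prod_unfold)
  ultimately have "wsum half b (Dx f) (Dx f) + 1 / 4 * wsum half b (Lx f) (Lx f)
       + - 1 * wsum one b (dx f) (dx f) = 0"
    using has_sum_unique by blast
  then show ?thesis by simp
qed

lemma wsum_dx_le:
  assumes [simp]: "weight b" "square_summable f"
  shows "wsum one b (dx f) (dx f) \<le> 4 * wsum one b f f"
proof -
  let ?S = "\<lambda>j k. f (Suc j) k"
  note [simp] = square_summable_Suc
  have G: "((\<lambda>(j, k). b k * (f (Suc j) k * f (Suc j) k)) has_sum wsum one b ?S ?S) UNIV"
    using has_sum_wsum[of one b ?S ?S] by (simp add: one_def)
  have G': "((\<lambda>(j, k). if j = 0 then 0 else b k * (f j k * f j k)) has_sum wsum one b ?S ?S) UNIV"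
    using has_sum_pred[OF G] by (simp cong: if_cong)
  have shift: "wsum one b ?S ?S \<le> wsum one b f f"
    by (rule has_sum_mono[OF G' has_sum_wsum[of one b f f]])
      (auto simp: one_def weight_def[THEN iffD1, OF assms(1)])
  have "wsum one b (dx f) (dx f) = wsum one b ?S ?S + wsum one b f f - 2 * wsum one b ?S f"
    by (subst (1 2) dx_def) (simp add: wsum_bilinear wsum_commute[of _ _ f ?S])
  moreover have "\<bar>wsum one b ?S f\<bar> \<le> 1 / 2 * wsum one b ?S ?S + 1 / 2 * wsum one b f f"
    using wsum_young[of one b ?S f "1 / 2"] by simp
  ultimately show ?thesis
    using shift by linarith
qed

lemma wsum_Dx_le:
  assumes "weight b" "square_summable f"
  shows "wsum half b (Dx f) (Dx f) \<le> wsum one b (dx f) (dx f)"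
  using wsum_dx_dx[OF assms] wsum_nonneg[of half b "Lx f"] assms by simp

lemma wsum_Lx_le:
  assumes "weight b" "square_summable f"
  shows "wsum half b (Lx f) (Lx f) \<le> 4 * wsum one b (dx f) (dx f)"
  using wsum_dx_dx[OF assms] wsum_nonneg[of half b "Dx f"] assms by simp

section \<open>Summation by parts in the second variable, by symmetry\<close>

lemma wsum_flip_left: "wsum a b (flip f) g = wsum b a f (flip g)"
  by (metis flip_flip wsum_flip)

lemma sbp_Dy:
  assumes "weight a" "square_summable f" "square_summable g"
  shows "wsum a half (Dy f) g + wsum a half f (Dy g) = - wsum a edge f g"
  using sbp_Dx[of a "flip f" "flip g"] assms
  by (simp add: Dy_def wsum_flip_left)

lemma sbp_Ly:
  assumes "weight a" "square_summable f" "square_summable g"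
  shows "wsum a half f (Ly g) = - wsum a one (dy f) (dy g) - wsum a edge f (dy g)"
  using sbp_Lx[of a "flip f" "flip g"] assms
  by (simp add: Ly_def dy_def wsum_flip_left)

lemma sbp_Dy_Ly:
  assumes "weight a" "square_summable f"
  shows "wsum a half (Dy f) (Ly f) = - 1 / 2 * wsum a edge (dy f) (dy f)"
  using sbp_Dx_Lx[of a "flip f"] assms
  by (simp add: Ly_def Dy_def dy_def wsum_flip_left)

lemma wsum_dy_dy:
  assumes "weight a" "square_summable f"
  shows "wsum a one (dy f) (dy f) = wsum a half (Dy f) (Dy f) + 1 / 4 * wsum a half (Ly f) (Ly f)"
  using wsum_dx_dx[of a "flip f"] assms
  by (simp add: Ly_def Dy_def dy_def wsum_flip_left)

lemma wsum_dy_le: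
  assumes "weight a" "square_summable f"
  shows "wsum a one (dy f) (dy f) \<le> 4 * wsum a one f f"
  using wsum_dx_le[of a "flip f"] assms
  by (simp add: dy_def wsum_flip_left)

lemma wsum_Dy_le:
  assumes "weight a" "square_summable f"
  shows "wsum a half (Dy f) (Dy f) \<le> wsum a one (dy f) (dy f)"
  using wsum_Dx_le[of a "flip f"] assms
  by (simp add: dy_def Dy_def wsum_flip_left)

lemma wsum_Ly_le:
  assumes "weight a" "square_summable f"
  shows "wsum a half (Ly f) (Ly f) \<le> 4 * wsum a one (dy f) (dy f)"
  using wsum_Lx_le[of a "flip f"] assms
  by (simp add: dy_def Ly_def wsum_flip_left)

subsection \<open>The energy balance of one time step\<close>

lemma wsum_u_Dx:
  assumes "weight b" "square_summable u"
  shows "wsum half b u (Dx u) = - 1 / 2 * wsum edge b u u"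
  using sbp_Dx[OF assms assms(2)] wsum_commute[of half b u "Dx u"] by simp

lemma wsum_u_Dy:
  assumes "weight a" "square_summable u"
  shows "wsum a half u (Dy u) = - 1 / 2 * wsum a edge u u"
  using sbp_Dy[OF assms assms(2)] wsum_commute[of a half u "Dy u"] by simp

text \<open>The growth caused by the centred difference is cancelled by the viscous term
  \<open>Lx\<close>. What survives is a trace term and a quarter of the square of
  \<open>Lx u\<close>, the source of the interior dissipation.\<close>

lemma wsum_u_Lx:
  assumes "weight b" "square_summable u"
  shows "wsum half b u (Lx u) + wsum half b (Dx u) (Dx u)
    = - wsum edge b u (dx u) - 1 / 4 * wsum half b (Lx u) (Lx u)"
  using sbp_Lx[OF assms assms(2)] wsum_dx_dx[OF assms] by simp

lemma wsum_u_Ly: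
  assumes "weight a" "square_summable u"
  shows "wsum a half u (Ly u) + wsum a half (Dy u) (Dy u)
    = - wsum a edge u (dy u) - 1 / 4 * wsum a half (Ly u) (Ly u)"
  using sbp_Ly[OF assms assms(2)] wsum_dy_dy[OF assms] by simp

abbreviation "N \<equiv> wsum half half"

lemma wsum_edge_one_le:
  assumes [simp]: "square_summable f"
  shows "wsum edge one f f \<le> 2 * wsum edge half f f" "wsum one edge f f \<le> 2 * wsum half edge f f"
  by (rule wsum_mono_weight; simp add: edge_def half_def one_def)+

lemma wsum_le_one_one:
  assumes [simp]: "square_summable f" "weight a" "weight b"
  shows "wsum a b f f \<le> wsum one one f f"
proof -
  have "wsum a b f f \<le> 1 * wsum one one f f"
    by (rule wsum_mono_weight) (use assms in \<open>auto simp: one_def weight_def mult_le_one\<close>)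
  then show ?thesis by simp
qed

definition first_order :: "(nat \<Rightarrow> nat \<Rightarrow> real) \<Rightarrow> real \<Rightarrow> real \<Rightarrow> nat \<Rightarrow> nat \<Rightarrow> real" where
  "first_order u p q = (\<lambda>j k. p * Dx u j k + q * Dy u j k)"

definition second_order :: "(nat \<Rightarrow> nat \<Rightarrow> real) \<Rightarrow> real \<Rightarrow> real \<Rightarrow> nat \<Rightarrow> nat \<Rightarrow> real" where
  "second_order u p q = (\<lambda>j k. (p\<^sup>2 / 2 * Lx u j k + q\<^sup>2 / 2 * Ly u j k)
     + (p * q * Dx (Dy u) j k + (- (p\<^sup>2 + q\<^sup>2) / 8) * Lx (Ly u) j k))"

definition lw_step :: "(nat \<Rightarrow> nat \<Rightarrow> real) \<Rightarrow> real \<Rightarrow> real \<Rightarrow> nat \<Rightarrow> nat \<Rightarrow> real" where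
  "lw_step u p q = (\<lambda>j k. u j k + (first_order u p q j k + second_order u p q j k))"

section \<open>Exact values of the second and third order inner products\<close>

context
  fixes u :: "nat \<Rightarrow> nat \<Rightarrow> real"
  assumes u [simp]: "square_summable u"
begin

lemma wsum_u_DxDy:
  "N u (Dx (Dy u)) + N (Dx u) (Dy u) = 1 / 2 * wsum edge edge u u"
  using sbp_Dx[of half u "Dy u"] wsum_u_Dy[of edge u] by simp

text \<open>Summation by parts in both variables. In the energy this carries the factor -(p^2 +
  q^2)/4, so the leading square is the dissipation of the mixed difference; the three trace terms
  have no sign.\<close>

lemma wsum_u_LxLy:
  "N u (Lx (Ly u)) = wsum one one (dy (dx u)) (dy (dx u)) + wsum one edge (dx u) (dy (dx u))
    + wsum edge one (dy u) (dy (dx u)) + wsum edge edge u (dy (dx u))"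
  using sbp_Lx[of half u "Ly u"] sbp_Ly[of one "dx u" "dx u"] sbp_Ly[of edge u "dx u"]
  by (simp add: commute_xy)

text \<open>In this and the next three identities one transverse difference is moved to the other
  factor. The interior sum then has the form <v, D v> or <D v, L v>, with v a transverse difference
  of \<open>u\<close>, and collapses to a boundary term.\<close>

lemma wsum_Dx_Ly:
  "N (Dx u) (Ly u) = 1 / 2 * wsum edge one (dy u) (dy u) - wsum half edge (Dx u) (dy u)"
  using sbp_Ly[of half "Dx u" u] wsum_u_Dx[of one "dy u"]
  by (simp add: commute_xy wsum_commute[of _ _ "dy (Dx u)" "dy u"])

lemma wsum_Dy_Lx:
  "N (Dy u) (Lx u) = 1 / 2 * wsum one edge (dx u) (dx u) - wsum edge half (Dy u) (dx u)"
  using sbp_Lx[of half "Dy u" u] wsum_u_Dy[of one "dx u"]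
  by (simp add: commute_xy wsum_commute[of _ _ "Dy (dx u)" "dx u"])

lemma wsum_Dx_LxLy:
  "N (Dx u) (Lx (Ly u)) = 1 / 2 * wsum edge one (dy (dx u)) (dy (dx u))
    - wsum half edge (Dx u) (dy (Lx u))"
  using sbp_Ly[of half "Dx u" "Lx u"] sbp_Dx_Lx[of one "dy u"]
  by (simp add: commute_xy)

lemma wsum_Dy_LxLy:
  "N (Dy u) (Lx (Ly u)) = 1 / 2 * wsum one edge (dy (dx u)) (dy (dx u))
    - wsum edge half (Dy u) (dx (Ly u))"
  using sbp_Lx[of half "Dy u" "Ly u"] sbp_Dy_Ly[of one "dx u"]
  by (simp add: commute_xy)

lemma wsum_Dx_DxDy:
  "N (Dx u) (Dx (Dy u)) = - 1 / 2 * wsum half edge (Dx u) (Dx u)"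
  "N (Dy u) (Dx (Dy u)) = - 1 / 2 * wsum edge half (Dy u) (Dy u)"
  using wsum_u_Dy[of half "Dx u"] wsum_u_Dx[of half "Dy u"] by (simp_all add: commute_xy)

section \<open>Bounds by the traces and the mixed difference\<close>

lemma wsum_edge_edge_le:
  "wsum edge edge u u \<le> wsum edge half u u + wsum half edge u u"
proof -
  have "wsum edge edge u u \<le> 2 * wsum edge half u u" "wsum edge edge u u \<le> 2 * wsum half edge u u"
    by (rule wsum_mono_weight; simp add: edge_def half_def)+
  then show ?thesis by linarith
qed

text \<open>A tangential difference of a trace is controlled by the trace itself: a factor 4 for the
  difference and a factor 2 for passing from \<open>one\<close> to \<open>half\<close>.\<close>

lemma wsum_edge_dy_le: "wsum edge one (dy u) (dy u) \<le> 8 * wsum edge half u u"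
  using wsum_dy_le[of edge u] wsum_edge_one_le[OF u] by simp

lemma wsum_edge_dx_le: "wsum one edge (dx u) (dx u) \<le> 8 * wsum half edge u u"
  using wsum_dx_le[of edge u] wsum_edge_one_le[OF u] by simp

text \<open>Young's inequality with parameter 2 costs 1/8 of the mixed dissipation for each of the
  three products, 3/8 in all, so most of it survives. The constant 18 is 2 * 8 + 2.\<close>

lemma wsum_LxLy_le:
  "\<bar>wsum one edge (dx u) (dy (dx u)) + wsum edge one (dy u) (dy (dx u)) + wsum edge edge u (dy (dx u))\<bar>
    \<le> 18 * (wsum edge half u u + wsum half edge u u) + 3 / 8 * wsum one one (dy (dx u)) (dy (dx u))"
proof -
  let ?z = "dy (dx u)"
  have "\<bar>wsum one edge (dx u) ?z\<bar> \<le> 2 * wsum one edge (dx u) (dx u) + 1 / 8 * wsum one edge ?z ?z"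
    "\<bar>wsum edge one (dy u) ?z\<bar> \<le> 2 * wsum edge one (dy u) (dy u) + 1 / 8 * wsum edge one ?z ?z"
    "\<bar>wsum edge edge u ?z\<bar> \<le> 2 * wsum edge edge u u + 1 / 8 * wsum edge edge ?z ?z"
    using wsum_young[of one edge "dx u" ?z 2] wsum_young[of edge one "dy u" ?z 2]
      wsum_young[of edge edge u ?z 2] by simp_all
  moreover have "wsum one edge ?z ?z \<le> wsum one one ?z ?z" "wsum edge one ?z ?z \<le> wsum one one ?z ?z"
    "wsum edge edge ?z ?z \<le> wsum one one ?z ?z"
    by (simp_all add: wsum_le_one_one)
  moreover have "\<bar>x + y + z\<bar> \<le> \<bar>x\<bar> + \<bar>y\<bar> + \<bar>z\<bar>" for x y z :: real
    by linarith
  note this[of "wsum one edge (dx u) ?z" "wsum edge one (dy u) ?z" "wsum edge edge u ?z"]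
  ultimately show ?thesis
    using wsum_edge_dx_le wsum_edge_dy_le wsum_edge_edge_le by argo
qed

lemma wsum_edge_Dx_le: "wsum half edge (Dx u) (Dx u) \<le> 8 * wsum half edge u u"
  using wsum_Dx_le[of edge u] wsum_edge_dx_le by simp

lemma wsum_edge_Dy_le: "wsum edge half (Dy u) (Dy u) \<le> 8 * wsum edge half u u"
  using wsum_Dy_le[of edge u] wsum_edge_dy_le by simp

lemma wsum_Dx_dyLx_le:
  "\<bar>wsum half edge (Dx u) (dy (Lx u))\<bar>
    \<le> 8 * wsum half edge u u + wsum one one (dy (dx u)) (dy (dx u))"
proof -
  have "\<bar>wsum half edge (Dx u) (dy (Lx u))\<bar>
      \<le> wsum half edge (Dx u) (Dx u) + 1 / 4 * wsum half edge (dy (Lx u)) (dy (Lx u))"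
    using wsum_young[of half edge "Dx u" "dy (Lx u)" 1] by simp
  \<comment> \<open>\<open>Lx\<close> is bounded by the single difference \<open>dx\<close>, so that
    this trace is dominated by the full sum of squares of the mixed difference.\<close>
  moreover have "wsum half edge (dy (Lx u)) (dy (Lx u)) \<le> 4 * wsum one one (dy (dx u)) (dy (dx u))"
    using wsum_Lx_le[of edge "dy u"] wsum_le_one_one[of "dy (dx u)" one edge]
    by (simp add: commute_xy)
  ultimately show ?thesis
    using wsum_edge_Dx_le by linarith
qed

lemma wsum_Dy_dxLy_le:
  "\<bar>wsum edge half (Dy u) (dx (Ly u))\<bar>
    \<le> 8 * wsum edge half u u + wsum one one (dy (dx u)) (dy (dx u))"
proof -
  have "\<bar>wsum edge half (Dy u) (dx (Ly u))\<bar>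
      \<le> wsum edge half (Dy u) (Dy u) + 1 / 4 * wsum edge half (dx (Ly u)) (dx (Ly u))"
    using wsum_young[of edge half "Dy u" "dx (Ly u)" 1] by simp
  moreover have "wsum edge half (dx (Ly u)) (dx (Ly u)) \<le> 4 * wsum one one (dy (dx u)) (dy (dx u))"
    using wsum_Ly_le[of edge "dx u"] wsum_le_one_one[of "dy (dx u)" edge one]
    by (simp add: commute_xy)
  ultimately show ?thesis
    using wsum_edge_Dy_le by linarith
qed

lemma wsum_DxDy_le: "N (Dx (Dy u)) (Dx (Dy u)) \<le> wsum one one (dy (dx u)) (dy (dx u))"
  using wsum_Dx_le[of half "Dy u"] wsum_Dy_le[of one "dx u"] by (simp add: commute_xy)

lemma wsum_LxLy_sq_le: "N (Lx (Ly u)) (Lx (Ly u)) \<le> 16 * wsum one one (dy (dx u)) (dy (dx u))"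
  using wsum_Lx_le[of half "Ly u"] wsum_Ly_le[of one "dx u"] by (simp add: commute_xy)

section \<open>Size of the second order part and expansion of one step\<close>

lemma square_summable_orders [simp]:
  "square_summable (first_order u p q)" "square_summable (second_order u p q)"
  "square_summable (lw_step u p q)"
proof -
  show "square_summable (first_order u p q)" "square_summable (second_order u p q)"
    unfolding first_order_def second_order_def
    by (intro square_summable_add square_summable_scale; simp)+
  then show "square_summable (lw_step u p q)"
    unfolding lw_step_def by (intro square_summable_add u)
qed

lemma wsum_second_order_right:
  assumes [simp]: "square_summable f"
  shows "N f (second_order u p q) = p\<^sup>2 / 2 * N f (Lx u) + q\<^sup>2 / 2 * N f (Ly u)
    + p * q * N f (Dx (Dy u)) + (- (p\<^sup>2 + q\<^sup>2) / 8) * N f (Lx (Ly u))"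
proof -
  have "N f (\<lambda>j k. (c * Lx u j k + c' * Ly u j k) + (d * Dx (Dy u) j k + d' * Lx (Ly u) j k))
      = c * N f (Lx u) + c' * N f (Ly u) + d * N f (Dx (Dy u)) + d' * N f (Lx (Ly u))" for c c' d d'
    by (simp add: wsum_bilinear)
  then show ?thesis
    unfolding second_order_def .
qed

text \<open>Two uses of |f + g|^2 \<le> 2 |f|^2 + 2 |g|^2 give a factor 4 for each of the four
  terms; the two mixed ones are merged by 4 p^2 q^2 \<le> (p^2 + q^2)^2. The products are bracketed
  so that each is a small factor times a dissipation term already present.\<close>

lemma wsum_second_order_le:
  fixes p q :: real
  defines "s \<equiv> p\<^sup>2 + q\<^sup>2"
  shows "N (second_order u p q) (second_order u p q)
    \<le> p\<^sup>2 * (p\<^sup>2 * N (Lx u) (Lx u)) + q\<^sup>2 * (q\<^sup>2 * N (Ly u) (Ly u))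
      + 2 * (s * (s * wsum one one (dy (dx u)) (dy (dx u))))"
proof -
  have add: "N (\<lambda>j k. f j k + g j k) (\<lambda>j k. f j k + g j k) \<le> 2 * N f f + 2 * N g g"
    if [simp]: "square_summable f" "square_summable g" for f g
    using wsum_young[of half half f g "1 / 2"]
    by (simp add: wsum_bilinear wsum_commute[of _ _ g f])
  have four: "N (\<lambda>j k. (c * Lx u j k + c' * Ly u j k) + (d * Dx (Dy u) j k + d' * Lx (Ly u) j k))
        (\<lambda>j k. (c * Lx u j k + c' * Ly u j k) + (d * Dx (Dy u) j k + d' * Lx (Ly u) j k))
      \<le> 4 * c\<^sup>2 * N (Lx u) (Lx u) + 4 * c'\<^sup>2 * N (Ly u) (Ly u)
        + 4 * d\<^sup>2 * N (Dx (Dy u)) (Dx (Dy u)) + 4 * d'\<^sup>2 * N (Lx (Ly u)) (Lx (Ly u))" for c c' d d'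
    using add[of "\<lambda>j k. c * Lx u j k + c' * Ly u j k" "\<lambda>j k. d * Dx (Dy u) j k + d' * Lx (Ly u) j k"]
      add[of "\<lambda>j k. c * Lx u j k" "\<lambda>j k. c' * Ly u j k"]
      add[of "\<lambda>j k. d * Dx (Dy u) j k" "\<lambda>j k. d' * Lx (Ly u) j k"]
    by (simp add: wsum_scale_left wsum_scale_right power2_eq_square mult.assoc)
  define Z where "Z = wsum one one (dy (dx u)) (dy (dx u))"
  have "Z \<ge> 0"
    unfolding Z_def by (rule wsum_nonneg) auto
  have "N (second_order u p q) (second_order u p q)
      \<le> p\<^sup>2 * (p\<^sup>2 * N (Lx u) (Lx u)) + q\<^sup>2 * (q\<^sup>2 * N (Ly u) (Ly u))
      + (4 * (p * q)\<^sup>2 * N (Dx (Dy u)) (Dx (Dy u)) + s\<^sup>2 / 16 * N (Lx (Ly u)) (Lx (Ly u)))"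
    unfolding second_order_def s_def[symmetric]
    by (rule order_trans[OF four]) (simp add: power2_eq_square)
  also have "4 * (p * q)\<^sup>2 * N (Dx (Dy u)) (Dx (Dy u)) + s\<^sup>2 / 16 * N (Lx (Ly u)) (Lx (Ly u))
      \<le> 4 * (p * q)\<^sup>2 * Z + s\<^sup>2 / 16 * (16 * Z)"
    unfolding Z_def by (intro add_mono mult_left_mono wsum_DxDy_le wsum_LxLy_sq_le) auto
  also have "4 * (p * q)\<^sup>2 \<le> s\<^sup>2"
    using zero_le_power2[of "p\<^sup>2 - q\<^sup>2"] by (simp add: s_def power2_eq_square algebra_simps)
  then have "4 * (p * q)\<^sup>2 * Z + s\<^sup>2 / 16 * (16 * Z) \<le> 2 * (s * (s * Z))"
    using mult_right_mono[OF _ \<open>Z \<ge> 0\<close>, of "4 * (p * q)\<^sup>2" "s\<^sup>2"]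
    by (simp add: power2_eq_square mult_ac)
  finally show ?thesis
    by (simp add: Z_def)
qed

text \<open>The right-hand side is sorted by order in \<open>p\<close> and \<open>q\<close>, from
  the traces of first order to the square of the second order part, which is of fourth order. Its
  summands have the shape in which \<open>energy_estimate\<close> bounds them one at a time.\<close>

lemma energy_balance:
  fixes p q :: real
  defines "s \<equiv> p\<^sup>2 + q\<^sup>2"
  shows "N (lw_step u p q) (lw_step u p q) - N u u =
    - (p * wsum edge half u u) - q * wsum half edge u u
    + (- p\<^sup>2 * wsum edge half u (dx u)) + (- q\<^sup>2 * wsum half edge u (dy u))
    - 1 / 4 * (p\<^sup>2 * N (Lx u) (Lx u)) - 1 / 4 * (q\<^sup>2 * N (Ly u) (Ly u))
    + p * q * wsum edge edge u u
    + (- s / 4 * (wsum one one (dy (dx u)) (dy (dx u)) + wsum one edge (dx u) (dy (dx u))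
        + wsum edge one (dy u) (dy (dx u)) + wsum edge edge u (dy (dx u))))
    - 1 / 2 * (p ^ 3 * wsum edge half (dx u) (dx u)) - 1 / 2 * (q ^ 3 * wsum half edge (dy u) (dy u))
    + p * q\<^sup>2 * (1 / 2 * wsum edge one (dy u) (dy u) - wsum half edge (Dx u) (dy u))
    + p\<^sup>2 * q * (1 / 2 * wsum one edge (dx u) (dx u) - wsum edge half (Dy u) (dx u))
    + (- p\<^sup>2 * q * wsum half edge (Dx u) (Dx u)) + (- p * q\<^sup>2 * wsum edge half (Dy u) (Dy u))
    + (- s * p / 4 * (1 / 2 * wsum edge one (dy (dx u)) (dy (dx u)) - wsum half edge (Dx u) (dy (Lx u))))
    + (- s * q / 4 * (1 / 2 * wsum one edge (dy (dx u)) (dy (dx u)) - wsum edge half (Dy u) (dx (Ly u))))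
    + N (second_order u p q) (second_order u p q)"
proof -
  let ?A = "first_order u p q" and ?B = "second_order u p q"
  have "N (lw_step u p q) (lw_step u p q) - N u u = 2 * N u ?A + (2 * N u ?B + N ?A ?A) + 2 * N ?A ?B + N ?B ?B"
    unfolding lw_step_def
    by (simp add: wsum_bilinear wsum_commute[of _ _ ?A u] wsum_commute[of _ _ ?B u] wsum_commute[of _ _ ?B ?A])
  moreover have "2 * N u ?A = - p * wsum edge half u u - q * wsum half edge u u"
    unfolding first_order_def by (simp add: wsum_bilinear wsum_u_Dx wsum_u_Dy)
  moreover have "2 * N u ?B + N ?A ?A =
      p\<^sup>2 * (N u (Lx u) + N (Dx u) (Dx u)) + q\<^sup>2 * (N u (Ly u) + N (Dy u) (Dy u))
      + 2 * p * q * (N u (Dx (Dy u)) + N (Dx u) (Dy u)) - s / 4 * N u (Lx (Ly u))"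
    by (simp add: wsum_second_order_right)
      (simp add: first_order_def s_def wsum_bilinear wsum_commute[of _ _ "Dy u" "Dx u"]
        power2_eq_square field_simps)
  moreover have "2 * N ?A ?B =
      p ^ 3 * N (Dx u) (Lx u) + q ^ 3 * N (Dy u) (Ly u) + p * q\<^sup>2 * N (Dx u) (Ly u) + p\<^sup>2 * q * N (Dy u) (Lx u)
      + 2 * (p\<^sup>2 * q) * N (Dx u) (Dx (Dy u)) + 2 * (p * q\<^sup>2) * N (Dy u) (Dx (Dy u))
      - s * p / 4 * N (Dx u) (Lx (Ly u)) - s * q / 4 * N (Dy u) (Lx (Ly u))"
    by (simp add: wsum_second_order_right)
      (simp add: first_order_def s_def wsum_bilinear power2_eq_square power3_eq_cube field_simps)
  ultimately show ?thesis
    unfolding wsum_u_Lx[of half u, simplified] wsum_u_Ly[of half u, simplified]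
      wsum_u_DxDy wsum_u_LxLy wsum_Dx_Ly wsum_Dy_Lx wsum_Dx_LxLy wsum_Dy_LxLy wsum_Dx_DxDy
      sbp_Dx_Lx[of half u, simplified] sbp_Dy_Ly[of half u, simplified]
    by (simp add: algebra_simps)
qed

end

section \<open>Absorption of the remaining terms\<close>

lemma energy_estimate:
  fixes p q M :: real
  assumes u [simp]: "square_summable u" and M: "M > 0" and p: "p > 0" and q: "q > 0"
    and pq: "p \<le> M * q" "q \<le> M * p"
    and small: "p\<^sup>2 + q\<^sup>2 \<le> (1 / (200 * (1 + M)))\<^sup>2"
  shows "N (lw_step u p q) (lw_step u p q) - N u u
    + p\<^sup>2 / 8 * N (Lx u) (Lx u) + q\<^sup>2 / 8 * N (Ly u) (Ly u)
    + p / 6 * wsum edge half u u + q / 6 * wsum half edge u u \<le> 0"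
proof -
  define s where "s = p\<^sup>2 + q\<^sup>2"
  define a where "a = wsum edge half u u"
  define a' where "a' = wsum half edge u u"
  define X where "X = N (Lx u) (Lx u)"
  define Y where "Y = N (Ly u) (Ly u)"
  define Z where "Z = wsum one one (dy (dx u)) (dy (dx u))"
  define d where "d = wsum edge half (dx u) (dx u)"
  define d' where "d' = wsum half edge (dy u) (dy u)"
  have nonneg: "a \<ge> 0" "a' \<ge> 0" "X \<ge> 0" "Y \<ge> 0" "Z \<ge> 0" "d \<ge> 0" "d' \<ge> 0"
    unfolding a_def a'_def X_def Y_def Z_def d_def d'_def by (simp_all add: wsum_nonneg)
  have "p \<le> 1 / (200 * (1 + M))" "q \<le> 1 / (200 * (1 + M))"
    by (rule power2_le_imp_le; use small M zero_le_power2[of p] zero_le_power2[of q] in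
        \<open>simp; linarith\<close>)+
  then have pM: "p * (1 + M) \<le> 1 / 200" and qM: "q * (1 + M) \<le> 1 / 200"
    using M by (simp_all add: field_simps)
  have "p * 1 \<le> p * (1 + M)" "q * 1 \<le> q * (1 + M)"
    using M p q by (intro mult_left_mono; simp)+
  then have p_le: "p \<le> 1 / 200" and q_le: "q \<le> 1 / 200"
    using pM qM by linarith+
  \<comment> \<open>Comparability of \<open>p\<close> and \<open>q\<close> is used here and in
    \<open>s_q\<close>: replacing q^2 by M p q makes s small relative to \<open>p\<close>, so that s
    * a can be absorbed by p * a. The factor 1 + M in the threshold is exactly what this
    costs.\<close>
  have s_p: "s \<le> p / 200"
  proof -
    have "s \<le> p * p + q * (M * p)"
      using pq q by (simp add: s_def power2_eq_square)
    also have "\<dots> \<le> p * (1 / 200 * (1 / (1 + M))) + (1 / 200 * (1 / (1 + M))) * (M * p)"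
      using pM qM M p by (intro add_mono mult_left_mono mult_right_mono) (auto simp: field_simps)
    also have "\<dots> = p / 200"
      using M by (simp add: divide_simps) (simp add: algebra_simps)
    finally show ?thesis .
  qed
  have s_q: "s \<le> q / 200"
  proof -
    have "s \<le> p * (M * q) + q * q"
      using pq p by (simp add: s_def power2_eq_square)
    also have "\<dots> \<le> (1 / 200 * (1 / (1 + M))) * (M * q) + q * (1 / 200 * (1 / (1 + M)))"
      using pM qM M q by (intro add_mono mult_left_mono mult_right_mono) (auto simp: field_simps)
    also have "\<dots> = q / 200"
      using M by (simp add: divide_simps) (simp add: algebra_simps)
    finally show ?thesis .
  qed
  have s: "s \<ge> 0" "s \<le> 1 / 200" "p\<^sup>2 \<le> s" "q\<^sup>2 \<le> s" "p * q \<le> s / 2"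
    using s_p p_le sum_squares_bound[of p q] by (auto simp: s_def)
  have sa: "s * a \<le> p * a / 200" and sa': "s * a' \<le> q * a' / 200"
    using mult_right_mono[OF s_p \<open>a \<ge> 0\<close>] mult_right_mono[OF s_q \<open>a' \<ge> 0\<close>] by auto
  have pqa: "p * q * a \<le> p * a / 200" and pqa': "p * q * a' \<le> q * a' / 200"
    using mult_right_mono[OF q_le, of "p * a"] mult_right_mono[OF p_le, of "q * a'"] p q nonneg
    by (auto simp: mult_ac)
  have pqqa: "p * q\<^sup>2 * a \<le> p * a / 200" and ppqa': "p\<^sup>2 * q * a' \<le> q * a' / 200"
    using mult_right_mono[of "q\<^sup>2" "1 / 200" "p * a"] mult_right_mono[of "p\<^sup>2" "1 / 200" "q * a'"]
      s p q nonneg by (auto simp: mult_ac)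
  have sqa: "s * q * a \<le> p * a / 200" and spa': "s * p * a' \<le> q * a' / 200"
    using mult_left_le_one_le[of "s * a" q] mult_left_le_one_le[of "s * a'" p] sa sa' s p q p_le q_le nonneg
    by (auto simp: mult_ac)
  have spZ: "s * p * Z \<le> s * Z / 200" and sqZ: "s * q * Z \<le> s * Z / 200"
    using mult_right_mono[OF p_le, of "s * Z"] mult_right_mono[OF q_le, of "s * Z"] s nonneg
    by (auto simp: mult_ac)

  \<comment> \<open>The form \<open>p x\<^sup>2 + p\<^sup>2 x y + p\<^sup>3 y\<^sup>2 / 2\<close> is positive definite; the Young parameter leaves
    \<open>p a / 3\<close> and \<open>p\<^sup>3 d / 8\<close> for the remaining terms, and \<open>r6\<close> uses all of \<open>p\<^sup>3 d / 8\<close>.\<close>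
  have r1: "- p\<^sup>2 * wsum edge half u (dx u) \<le> 2 / 3 * (p * a) + 3 / 8 * (p ^ 3 * d)"
  proof -
    have "- p\<^sup>2 * wsum edge half u (dx u) \<le> p\<^sup>2 * \<bar>wsum edge half u (dx u)\<bar>"
      using p by (simp add: abs_if mult_nonneg_nonpos)
    also have "\<dots> \<le> p\<^sup>2 * (2 / (3 * p) * a + 1 / (4 * (2 / (3 * p))) * d)"
      unfolding a_def d_def using p by (intro mult_left_mono wsum_young) auto
    also have "\<dots> = 2 / 3 * (p * a) + 3 / 8 * (p ^ 3 * d)"
      using p by (simp add: field_simps power2_eq_square power3_eq_cube)
    finally show ?thesis .
  qed
  have r2: "- q\<^sup>2 * wsum half edge u (dy u) \<le> 2 / 3 * (q * a') + 3 / 8 * (q ^ 3 * d')"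
  proof -
    have "- q\<^sup>2 * wsum half edge u (dy u) \<le> q\<^sup>2 * \<bar>wsum half edge u (dy u)\<bar>"
      using q by (simp add: abs_if mult_nonneg_nonpos)
    also have "\<dots> \<le> q\<^sup>2 * (2 / (3 * q) * a' + 1 / (4 * (2 / (3 * q))) * d')"
      unfolding a'_def d'_def using q by (intro mult_left_mono wsum_young) auto
    also have "\<dots> = 2 / 3 * (q * a') + 3 / 8 * (q ^ 3 * d')"
      using q by (simp add: field_simps power2_eq_square power3_eq_cube)
    finally show ?thesis .
  qed
  have r3: "p * q * wsum edge edge u u \<le> p * a / 200 + q * a' / 200"
  proof -
    have "p * q * wsum edge edge u u \<le> p * q * (a + a')"
      unfolding a_def a'_def using p q by (intro mult_left_mono wsum_edge_edge_le u) auto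
    then show ?thesis using pqa pqa' by (simp only: distrib_left)
  qed
  have r4: "- s / 4 * (Z + wsum one edge (dx u) (dy (dx u)) + wsum edge one (dy u) (dy (dx u))
        + wsum edge edge u (dy (dx u))) \<le> 9 / 2 * (p * a / 200 + q * a' / 200) - 5 / 32 * (s * Z)"
  proof -
    define W where "W = wsum one edge (dx u) (dy (dx u)) + wsum edge one (dy u) (dy (dx u))
        + wsum edge edge u (dy (dx u))"
    \<comment> \<open>Of the coefficient 1/4 of s * Z, the fraction 3/8 is spent on W, which leaves
      5/32.\<close>
    have "- W \<le> 18 * (a + a') + 3 / 8 * Z"
      using wsum_LxLy_le[OF u] unfolding W_def a_def a'_def Z_def by linarith
    then have "s / 4 * - W \<le> s / 4 * (18 * (a + a') + 3 / 8 * Z)"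
      using s by (intro mult_left_mono) auto
    also have "\<dots> = 9 / 2 * (s * a + s * a') + 3 / 32 * (s * Z)"
      by (simp add: algebra_simps)
    also have "\<dots> \<le> 9 / 2 * (p * a / 200 + q * a' / 200) + 3 / 32 * (s * Z)"
      using sa sa' by (intro add_right_mono mult_left_mono add_mono) auto
    finally have "s / 4 * - W \<le> 9 / 2 * (p * a / 200 + q * a' / 200) + 3 / 32 * (s * Z)" .
    moreover have "- s / 4 * (Z + W) = s / 4 * - W - 1 / 4 * (s * Z)"
      by (simp add: field_simps)
    ultimately have "- s / 4 * (Z + W) \<le> 9 / 2 * (p * a / 200 + q * a' / 200) - 5 / 32 * (s * Z)"
      by argo
    then show ?thesis by (simp add: W_def add.assoc)
  qed
  have r5: "p * q\<^sup>2 * (1 / 2 * wsum edge one (dy u) (dy u) - wsum half edge (Dx u) (dy u))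
      \<le> 4 * (p * a / 200) + 16 * (q * a' / 200) + 1 / 8 * (q ^ 3 * d')"
  proof -
    \<comment> \<open>After multiplication by p q^2, the parameter 2 p / q yields 16 p^2 q a' and
      q^3 d' / 8, the latter being all that \<open>r2\<close> leaves of q^3 d' / 2.\<close>
    have "\<bar>wsum half edge (Dx u) (dy u)\<bar> \<le> 2 * p / q * wsum half edge (Dx u) (Dx u) + 1 / (4 * (2 * p / q)) * d'"
      unfolding d'_def using p q by (intro wsum_young) auto
    also have "\<dots> \<le> 2 * p / q * (8 * a') + q / (8 * p) * d'"
      using wsum_edge_Dx_le[OF u] p q unfolding a'_def by (intro add_mono mult_left_mono) auto
    finally have "1 / 2 * wsum edge one (dy u) (dy u) - wsum half edge (Dx u) (dy u)
        \<le> 4 * a + (2 * p / q * (8 * a') + q / (8 * p) * d')"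
      using wsum_edge_dy_le[OF u] unfolding a_def by linarith
    then have "p * q\<^sup>2 * (1 / 2 * wsum edge one (dy u) (dy u) - wsum half edge (Dx u) (dy u))
        \<le> p * q\<^sup>2 * (4 * a + (2 * p / q * (8 * a') + q / (8 * p) * d'))"
      using p by (intro mult_left_mono) auto
    also have "\<dots> = 4 * (p * q\<^sup>2 * a) + 16 * (p\<^sup>2 * q * a') + 1 / 8 * (q ^ 3 * d')"
      using p q by (simp add: field_simps power2_eq_square power3_eq_cube)
    finally show ?thesis using pqqa ppqa' by linarith
  qed
  have r6: "p\<^sup>2 * q * (1 / 2 * wsum one edge (dx u) (dx u) - wsum edge half (Dy u) (dx u))
      \<le> 4 * (q * a' / 200) + 16 * (p * a / 200) + 1 / 8 * (p ^ 3 * d)"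
  proof -
    have "\<bar>wsum edge half (Dy u) (dx u)\<bar> \<le> 2 * q / p * wsum edge half (Dy u) (Dy u) + 1 / (4 * (2 * q / p)) * d"
      unfolding d_def using p q by (intro wsum_young) auto
    also have "\<dots> \<le> 2 * q / p * (8 * a) + p / (8 * q) * d"
      using wsum_edge_Dy_le[OF u] p q unfolding a_def by (intro add_mono mult_left_mono) auto
    finally have "1 / 2 * wsum one edge (dx u) (dx u) - wsum edge half (Dy u) (dx u)
        \<le> 4 * a' + (2 * q / p * (8 * a) + p / (8 * q) * d)"
      using wsum_edge_dx_le[OF u] unfolding a'_def by linarith
    then have "p\<^sup>2 * q * (1 / 2 * wsum one edge (dx u) (dx u) - wsum edge half (Dy u) (dx u))
        \<le> p\<^sup>2 * q * (4 * a' + (2 * q / p * (8 * a) + p / (8 * q) * d))"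
      using q by (intro mult_left_mono) auto
    also have "\<dots> = 4 * (p\<^sup>2 * q * a') + 16 * (p * q\<^sup>2 * a) + 1 / 8 * (p ^ 3 * d)"
      using p q by (simp add: field_simps power2_eq_square power3_eq_cube)
    finally show ?thesis using pqqa ppqa' by linarith
  qed
  \<comment> \<open>The third order products with \<open>Dx (Dy u)\<close> have a favourable sign
    and are dropped.\<close>
  have r7: "- p\<^sup>2 * q * wsum half edge (Dx u) (Dx u) \<le> 0" "- p * q\<^sup>2 * wsum edge half (Dy u) (Dy u) \<le> 0"
    using wsum_nonneg[of half edge "Dx u"] wsum_nonneg[of edge half "Dy u"] p q by auto
  have neg: "- s * x / 4 * w = s * x / 4 * - w" for x w
    by simp
  have r8: "- s * p / 4 * (1 / 2 * wsum edge one (dy (dx u)) (dy (dx u)) - wsum half edge (Dx u) (dy (Lx u)))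
      \<le> 2 * (q * a' / 200) + 1 / 4 * (s * Z / 200)"
  proof -
    have "- (1 / 2 * wsum edge one (dy (dx u)) (dy (dx u)) - wsum half edge (Dx u) (dy (Lx u))) \<le> 8 * a' + Z"
      using wsum_Dx_dyLx_le[OF u] wsum_nonneg[of edge one "dy (dx u)"] unfolding a'_def Z_def by simp
    then have "s * p / 4 * - (1 / 2 * wsum edge one (dy (dx u)) (dy (dx u)) - wsum half edge (Dx u) (dy (Lx u)))
        \<le> s * p / 4 * (8 * a' + Z)"
      using s p by (intro mult_left_mono) auto
    also have "\<dots> = 2 * (s * p * a') + 1 / 4 * (s * p * Z)"
      by (simp add: algebra_simps)
    finally show ?thesis
      unfolding neg using spa' spZ by linarith
  qed
  have r9: "- s * q / 4 * (1 / 2 * wsum one edge (dy (dx u)) (dy (dx u)) - wsum edge half (Dy u) (dx (Ly u)))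
      \<le> 2 * (p * a / 200) + 1 / 4 * (s * Z / 200)"
  proof -
    have "- (1 / 2 * wsum one edge (dy (dx u)) (dy (dx u)) - wsum edge half (Dy u) (dx (Ly u))) \<le> 8 * a + Z"
      using wsum_Dy_dxLy_le[OF u] wsum_nonneg[of one edge "dy (dx u)"] unfolding a_def Z_def by simp
    then have "s * q / 4 * - (1 / 2 * wsum one edge (dy (dx u)) (dy (dx u)) - wsum edge half (Dy u) (dx (Ly u)))
        \<le> s * q / 4 * (8 * a + Z)"
      using s q by (intro mult_left_mono) auto
    also have "\<dots> = 2 * (s * q * a) + 1 / 4 * (s * q * Z)"
      by (simp add: algebra_simps)
    finally show ?thesis
      unfolding neg using sqa sqZ by linarith
  qed
  have r10: "N (second_order u p q) (second_order u p q)
      \<le> 1 / 200 * (p\<^sup>2 * X) + 1 / 200 * (q\<^sup>2 * Y) + 2 * (1 / 200 * (s * Z))"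
  proof -
    have "N (second_order u p q) (second_order u p q)
        \<le> p\<^sup>2 * (p\<^sup>2 * X) + q\<^sup>2 * (q\<^sup>2 * Y) + 2 * (s * (s * Z))"
      using wsum_second_order_le[OF u] unfolding X_def Y_def Z_def s_def .
    also have "\<dots> \<le> 1 / 200 * (p\<^sup>2 * X) + 1 / 200 * (q\<^sup>2 * Y) + 2 * (1 / 200 * (s * Z))"
      using s nonneg by (intro add_mono mult_left_mono mult_right_mono) auto
    finally show ?thesis .
  qed
  have "s * Z \<ge> 0" "p\<^sup>2 * X \<ge> 0" "q\<^sup>2 * Y \<ge> 0" "p * a \<ge> 0" "q * a' \<ge> 0"
    using s p q nonneg by auto
  \<comment> \<open>The budget: beyond \<open>r1\<close>, the terms in p * a add up to 27.5/200, and
    1/3 - 27.5/200 exceeds 1/6; likewise for q * a'. The d terms cancel by 3/8 + 1/8 = 1/2, s * Z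
    has 5/32 against 1/80, and X and Y keep 1/4 - 1/200, more than 1/8.\<close>
  then have "N (lw_step u p q) (lw_step u p q) - N u u + 1 / 8 * (p\<^sup>2 * X) + 1 / 8 * (q\<^sup>2 * Y)
      + 1 / 6 * (p * a) + 1 / 6 * (q * a') \<le> 0"
    using energy_balance[OF u, of p q] r1 r2 r3 r4 r5 r6 r7 r8 r9 r10
    unfolding a_def[symmetric] a'_def[symmetric] X_def[symmetric] Y_def[symmetric] Z_def[symmetric]
      d_def[symmetric] d'_def[symmetric] s_def[symmetric]
    by argo
  then show ?thesis
    by (simp add: a_def a'_def X_def Y_def)
qed

subsection \<open>The scheme in terms of difference operators\<close>

lemma stencil_eq_step:
  "lax_wendroff_stencil a b lam mu (with_ghosts u) (int j) (int k)
    = lw_step u (- (lam * a)) (- (mu * b)) j k"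
\<comment> \<open>At index 0 the ghost values turn the centred difference into the one-sided one and
  annihilate the second difference. The corner value is the extrapolation in both variables
  composed, so the mixed operators also match at the corner.\<close>
proof (cases j; cases k)
qed (auto simp: lax_wendroff_stencil_def with_ghosts_def lw_step_def first_order_def second_order_def
    Dx_def Lx_def Dy_def Ly_def flip_def nat_add_distrib field_simps power2_eq_square)

lemma square_summable_lax_wendroff:
  assumes "square_summable u0"
  shows "square_summable (lax_wendroff a b lam mu u0 n)"
  by (induction n) (simp_all add: assms stencil_eq_step)

lemma infsum_edge: "(\<Sum>\<^sub>\<infinity>k. (u 0 k)\<^sup>2) = wsum edge one u u"
proof -
  have "wsum edge one u u = (\<Sum>\<^sub>\<infinity>(j, k)\<in>range (Pair 0). (u j k)\<^sup>2)"
    unfolding wsum_def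
    by (rule infsum_cong_neutral) (auto simp: edge_def one_def power2_eq_square image_def)
  also have "\<dots> = (\<Sum>\<^sub>\<infinity>k. (u 0 k)\<^sup>2)"
    by (simp add: infsum_reindex inj_on_def o_def)
  finally show ?thesis by simp
qed

lemma infsum_edge': "(\<Sum>\<^sub>\<infinity>j. (u j 0)\<^sup>2) = wsum one edge u u"
  using infsum_edge[of "flip u"] wsum_flip[of edge one u u]
  by (simp add: flip_def)

text \<open>The quadrant splits into the interior, two open edges and the corner, where the product
  of the weights is 1, 1/2, 1/2 and 1/4.\<close>

lemma norm_sq_eq_wsum:
  assumes u: "square_summable u"
  shows "norm_sq u = N u u"
proof -
  define F where "F = (\<lambda>(j, k). half j * half k * (u j k * u j k))"
  have F: "F summable_on A" for A
    unfolding F_def using u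
    by (intro summable_on_subset_banach[OF has_sum_imp_summable[OF has_sum_wsum[of half half u u]]]) auto
  have "x \<in> ({1..} \<times> {1..} \<union> {0} \<times> {1..}) \<union> ({1..} \<times> {0} \<union> {(0, 0)})" for x :: "nat \<times> nat"
    by (cases x; cases "fst x"; cases "snd x") auto
  then have "UNIV = ({1..} \<times> {1..} \<union> {0} \<times> {1..}) \<union> ({1..} \<times> {0} \<union> {(0 :: nat, 0 :: nat)})"
    by blast
  then have "N u u = infsum F (({1..} \<times> {1..} \<union> {0} \<times> {1..}) \<union> ({1..} \<times> {0} \<union> {(0, 0)}))"
    by (simp add: wsum_def F_def)
  also have "\<dots> = infsum F ({1..} \<times> {1..}) + infsum F ({0} \<times> {1..})
      + (infsum F ({1..} \<times> {0}) + infsum F {(0, 0)})"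
    by (subst infsum_Un_disjoint; (intro F)?; force?)+
  also have "infsum F ({1..} \<times> {1..}) = (\<Sum>\<^sub>\<infinity>(j, k)\<in>{1..} \<times> {1..}. (u j k)\<^sup>2)"
    by (rule infsum_cong) (auto simp: F_def half_def power2_eq_square)
  also have "{0 :: nat} \<times> {1 :: nat..} = Pair 0 ` {1..}"
    by auto
  also have "infsum F (Pair 0 ` {1..}) = (\<Sum>\<^sub>\<infinity>k\<in>{1..}. 1 / 2 * (u 0 k)\<^sup>2)"
    by (subst infsum_reindex) (auto simp: F_def half_def power2_eq_square inj_on_def intro!: infsum_cong)
  also have "{1 :: nat..} \<times> {0 :: nat} = (\<lambda>j. (j, 0)) ` {1..}"
    by auto
  also have "infsum F ((\<lambda>j. (j, 0)) ` {1..}) = (\<Sum>\<^sub>\<infinity>j\<in>{1..}. 1 / 2 * (u j 0)\<^sup>2)"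
    by (subst infsum_reindex) (auto simp: F_def half_def power2_eq_square inj_on_def intro!: infsum_cong)
  also have "infsum F {(0, 0)} = 1 / 4 * (u 0 0)\<^sup>2"
    by (simp add: F_def half_def power2_eq_square)
  finally show ?thesis
    unfolding norm_sq_def by (simp only: infsum_cmult_right' add.assoc)
qed

text \<open>On j, k \<ge> 1 the weights are 1 and \<open>j - 1\<close> is a true predecessor. The
  form on the right also counts the row k = 0, hence an inequality only.\<close>

lemma infsum_Lx_le:
  assumes u: "square_summable u"
  shows "(\<Sum>\<^sub>\<infinity>(j, k)\<in>{1..} \<times> {1..}. (u (j - 1) k - 2 * u j k + u (j + 1) k)\<^sup>2) \<le> N (Lx u) (Lx u)"
proof -
  define F where "F = (\<lambda>(j, k). half j * half k * (Lx u j k * Lx u j k))"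
  have F: "F summable_on A" for A
    unfolding F_def using u
    by (intro summable_on_subset_banach[OF has_sum_imp_summable[OF has_sum_wsum[of half half "Lx u" "Lx u"]]])
      auto
  have "(\<Sum>\<^sub>\<infinity>(j, k)\<in>{1..} \<times> {1..}. (u (j - 1) k - 2 * u j k + u (j + 1) k)\<^sup>2) = infsum F ({1..} \<times> {1..})"
    by (rule infsum_cong) (auto simp: F_def half_def Lx_def power2_eq_square algebra_simps)
  also have "\<dots> \<le> infsum F UNIV"
    by (rule infsum_mono_neutral[OF F F]) (auto simp: F_def half_def)
  finally show ?thesis
    by (simp add: F_def wsum_def)
qed

lemma infsum_Ly_le:
  assumes u: "square_summable u"
  shows "(\<Sum>\<^sub>\<infinity>(j, k)\<in>{1..} \<times> {1..}. (u j (k - 1) - 2 * u j k + u j (k + 1))\<^sup>2) \<le> N (Ly u) (Ly u)"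
proof -
  have "bij_betw prod.swap ({1 :: nat..} \<times> {1 :: nat..}) ({1..} \<times> {1..})"
    by (auto simp: bij_betw_def inj_on_def image_def)
  from infsum_reindex_bij_betw[OF this,
      of "\<lambda>(j, k). (u j (k - 1) - 2 * u j k + u j (k + 1))\<^sup>2"]
  show ?thesis
    using infsum_Lx_le[OF square_summable_flip[THEN iffD2, OF u]]
    by (simp add: flip_def[of u] case_prod_unfold Ly_def wsum_flip_left)
qed

theorem theorem3p1:
  "\<exists>c::real. c > 0 \<and>
    (\<forall>M::real. M > 0 \<longrightarrow>
      (\<exists>\<epsilon>::real. \<epsilon> > 0 \<and>
        (\<forall>(a::real) (b::real) (lam::real) (mu::real) (u0 :: nat \<Rightarrow> nat \<Rightarrow> real).
          a < 0 \<longrightarrow> b < 0 \<longrightarrow> lam > 0 \<longrightarrow> mu > 0 \<longrightarrow>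
          lam * \<bar>a\<bar> \<le> M * (mu * \<bar>b\<bar>) \<longrightarrow> mu * \<bar>b\<bar> \<le> M * (lam * \<bar>a\<bar>) \<longrightarrow>
          (lam * a)\<^sup>2 + (mu * b)\<^sup>2 \<le> \<epsilon> \<longrightarrow>
          square_summable u0 \<longrightarrow>
          (\<forall>n. let u = lax_wendroff a b lam mu u0 in
            norm_sq (u (Suc n)) - norm_sq (u n)
            + c * (lam * a)\<^sup>2 *
                (\<Sum>\<^sub>\<infinity>(j, k)\<in>{1..} \<times> {1..}. (u n (j - 1) k - 2 * u n j k + u n (j + 1) k)\<^sup>2)
            + c * (mu * b)\<^sup>2 *
                (\<Sum>\<^sub>\<infinity>(j, k)\<in>{1..} \<times> {1..}. (u n j (k - 1) - 2 * u n j k + u n j (k + 1))\<^sup>2)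
            + c * lam * \<bar>a\<bar> * (\<Sum>\<^sub>\<infinity>k\<in>UNIV. (u n 0 k)\<^sup>2)
            + c * mu * \<bar>b\<bar> * (\<Sum>\<^sub>\<infinity>j\<in>UNIV. (u n j 0)\<^sup>2) \<le> 0))))"
proof (rule exI[of _ "1 / 12"], intro conjI allI impI)
  fix M :: real
  assume M: "M > 0"
  show "\<exists>\<epsilon>::real. \<epsilon> > 0 \<and>
        (\<forall>(a::real) (b::real) (lam::real) (mu::real) (u0 :: nat \<Rightarrow> nat \<Rightarrow> real).
          a < 0 \<longrightarrow> b < 0 \<longrightarrow> lam > 0 \<longrightarrow> mu > 0 \<longrightarrow>
          lam * \<bar>a\<bar> \<le> M * (mu * \<bar>b\<bar>) \<longrightarrow> mu * \<bar>b\<bar> \<le> M * (lam * \<bar>a\<bar>) \<longrightarrow>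
          (lam * a)\<^sup>2 + (mu * b)\<^sup>2 \<le> \<epsilon> \<longrightarrow>
          square_summable u0 \<longrightarrow>
          (\<forall>n. let u = lax_wendroff a b lam mu u0 in
            norm_sq (u (Suc n)) - norm_sq (u n)
            + 1 / 12 * (lam * a)\<^sup>2 *
                (\<Sum>\<^sub>\<infinity>(j, k)\<in>{1..} \<times> {1..}. (u n (j - 1) k - 2 * u n j k + u n (j + 1) k)\<^sup>2)
            + 1 / 12 * (mu * b)\<^sup>2 *
                (\<Sum>\<^sub>\<infinity>(j, k)\<in>{1..} \<times> {1..}. (u n j (k - 1) - 2 * u n j k + u n j (k + 1))\<^sup>2)
            + 1 / 12 * lam * \<bar>a\<bar> * (\<Sum>\<^sub>\<infinity>k\<in>UNIV. (u n 0 k)\<^sup>2)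
            + 1 / 12 * mu * \<bar>b\<bar> * (\<Sum>\<^sub>\<infinity>j\<in>UNIV. (u n j 0)\<^sup>2) \<le> 0))"
  proof (rule exI[of _ "(1 / (200 * (1 + M)))\<^sup>2"], intro conjI allI impI)
    fix a b lam mu :: real and u0 :: "nat \<Rightarrow> nat \<Rightarrow> real" and n
    assume neg: "a < 0" "b < 0" and pos: "lam > 0" "mu > 0"
      and ratio: "lam * \<bar>a\<bar> \<le> M * (mu * \<bar>b\<bar>)" "mu * \<bar>b\<bar> \<le> M * (lam * \<bar>a\<bar>)"
      and small: "(lam * a)\<^sup>2 + (mu * b)\<^sup>2 \<le> (1 / (200 * (1 + M)))\<^sup>2"
      and u0: "square_summable u0"
    define p where "p = - (lam * a)"
    define q where "q = - (mu * b)"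
    define v where "v = lax_wendroff a b lam mu u0 n"
    have v [simp]: "square_summable v"
      unfolding v_def by (rule square_summable_lax_wendroff[OF u0])
    have p: "p > 0" "lam * \<bar>a\<bar> = p" "(lam * a)\<^sup>2 = p\<^sup>2"
      and q: "q > 0" "mu * \<bar>b\<bar> = q" "(mu * b)\<^sup>2 = q\<^sup>2"
      using neg pos by (simp_all add: p_def q_def mult_pos_neg)
    have step: "lax_wendroff a b lam mu u0 (Suc n) = lw_step v p q"
      by (simp add: stencil_eq_step v_def p_def q_def)
    \<comment> \<open>The traces of the theorem give the corner full weight, those of
      \<open>energy_estimate\<close> weight 1/2. This factor 2 turns 1/6 into c = 1/12, which is
      also below the interior constant 1/8.\<close>
    have "p / 12 * wsum edge one v v \<le> p / 6 * wsum edge half v v"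
      "q / 12 * wsum one edge v v \<le> q / 6 * wsum half edge v v"
      using mult_left_mono[OF wsum_edge_one_le(1)[OF v], of "p / 12"]
        mult_left_mono[OF wsum_edge_one_le(2)[OF v], of "q / 12"] p q by simp_all
    moreover have "p\<^sup>2 / 12 * (\<Sum>\<^sub>\<infinity>(j, k)\<in>{1..} \<times> {1..}. (v (j - 1) k - 2 * v j k + v (j + 1) k)\<^sup>2)
        \<le> p\<^sup>2 / 8 * N (Lx v) (Lx v)"
      "q\<^sup>2 / 12 * (\<Sum>\<^sub>\<infinity>(j, k)\<in>{1..} \<times> {1..}. (v j (k - 1) - 2 * v j k + v j (k + 1))\<^sup>2)
        \<le> q\<^sup>2 / 8 * N (Ly v) (Ly v)"
      using infsum_Lx_le[OF v] infsum_Ly_le[OF v]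
      by (intro mult_mono; simp add: wsum_nonneg infsum_nonneg case_prod_unfold)+
    moreover have "N (lw_step v p q) (lw_step v p q) - N v v
        + p\<^sup>2 / 8 * N (Lx v) (Lx v) + q\<^sup>2 / 8 * N (Ly v) (Ly v)
        + p / 6 * wsum edge half v v + q / 6 * wsum half edge v v \<le> 0"
      using energy_estimate[OF v M p(1) q(1)] ratio small unfolding p q by blast
    moreover have "1 / 12 * (lam * a)\<^sup>2 = p\<^sup>2 / 12" "1 / 12 * (mu * b)\<^sup>2 = q\<^sup>2 / 12"
      "1 / 12 * lam * \<bar>a\<bar> = p / 12" "1 / 12 * mu * \<bar>b\<bar> = q / 12"
      using p q by simp_all
    note coeffs = this
    ultimately show "let u = lax_wendroff a b lam mu u0 in
            norm_sq (u (Suc n)) - norm_sq (u n)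
            + 1 / 12 * (lam * a)\<^sup>2 *
                (\<Sum>\<^sub>\<infinity>(j, k)\<in>{1..} \<times> {1..}. (u n (j - 1) k - 2 * u n j k + u n (j + 1) k)\<^sup>2)
            + 1 / 12 * (mu * b)\<^sup>2 *
                (\<Sum>\<^sub>\<infinity>(j, k)\<in>{1..} \<times> {1..}. (u n j (k - 1) - 2 * u n j k + u n j (k + 1))\<^sup>2)
            + 1 / 12 * lam * \<bar>a\<bar> * (\<Sum>\<^sub>\<infinity>k\<in>UNIV. (u n 0 k)\<^sup>2)
            + 1 / 12 * mu * \<bar>b\<bar> * (\<Sum>\<^sub>\<infinity>j\<in>UNIV. (u n j 0)\<^sup>2) \<le> 0"
      unfolding Let_def step v_def[symmetric] coeffs
        norm_sq_eq_wsum[OF v] norm_sq_eq_wsum[OF square_summable_orders(3)[OF v]]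
        infsum_edge infsum_edge'
      by linarith
  qed (use M in simp)
qed simp

end
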